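(* Let $T>0$, let $X:[0,T]^2\to\mathbb{R}^d$ be a smooth field, let $A^1,\dots,A^d\in\mathbb{R}^{e\times e}$ be constant matrices, $v\in\mathbb{R}^e$, $\mathbf s=(s_1,s_2)\in[0,T]^2$ and $\mathbf T=(T,T)$. Let $Y:[\mathbf s,\mathbf T]\to\mathbb{R}^e$ be the (continuous) solution of the linear equation $$Y_{\mathbf t}=v+\sum_{i=1}^d\int_{[\mathbf s,\mathbf t]}A^iY_{\mathbf r}\,d^iX_{\mathbf r},\qquad \mathbf t\in[\mathbf s,\mathbf T].$$ Then for every $\mathbf t\in[\mathbf s,\mathbf T]$ the rectangular increment of $Y$ admits the convergent expansion $$\square_{\mathbf s\mathbf t}Y=\sum_{w\in\mathcal W\setminus\{\mathsf e\}}A^{\circ w}v\,\langle\mathbf S^{\mathrm{id}}_{\mathbf s\mathbf t}(X),w\rangle .$$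
   Context: $[\mathbf s,\mathbf t]=[s_1,t_1]\times[s_2,t_2]$. $d^iX_{\mathbf r}=\frac{\partial^2X^i}{\partial r_1\partial r_2}(\mathbf r)\,dr_1dr_2$. Rectangular increment: $\square_{\mathbf s\mathbf t}Y=Y_{t_1,t_2}-Y_{s_1,t_2}-Y_{t_1,s_2}+Y_{s_1,s_2}$. $\mathcal W$ is the set of all finite words in the alphabet $\{1,\dots,d\}$ and $\mathsf e$ the empty word. For $w=(i_1,\dots,i_n)$, $n\ge1$, $A^{\circ w}=A^{i_n}\cdots A^{i_1}$. $\mathrm{id}$-signature: $\langle\mathbf S^{\mathrm{id}}_{\mathbf s\mathbf t}(X),\mathsf e\rangle=1$ and, for $w=(i_1,\dots,i_n)$, $n\ge 1$, $$\langle\mathbf S^{\mathrm{id}}_{\mathbf s\mathbf t}(X),w\rangle=\int_{[\mathbf s,\mathbf t]}\langle\mathbf S^{\mathrm{id}}_{\mathbf s\mathbf r}(X),(i_1,\dots,i_{n-1})\rangle\,d^{i_n}X_{\mathbf r}.$$ *)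

theory Defs
  imports "HOL-Analysis.Analysis"
begin

text \<open>
  Differentiability classes on a set that need not be open. For the square
  \<open>{0..T} \<times> {0..T}\<close> with \<open>T > 0\<close> the derivative within the set is unique (one-sided at the
  boundary), so the existential below does not leave a choice.
\<close>

primrec Ck_on ::
  "nat \<Rightarrow> 'a::real_normed_vector set \<Rightarrow> ('a \<Rightarrow> 'b::real_normed_vector) \<Rightarrow> bool"
where
  "Ck_on 0 S f \<longleftrightarrow> continuous_on S f"
| "Ck_on (Suc k) S f \<longleftrightarrow>
     (\<exists>f'. (\<forall>x\<in>S. (f has_derivative f' x) (at x within S)) \<and> (\<forall>h. Ck_on k S (\<lambda>x. f' x h)))"

definition smooth_on :: "'a::real_normed_vector set \<Rightarrow> ('a \<Rightarrow> 'b::real_normed_vector) \<Rightarrow> bool"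
  where "smooth_on S f \<longleftrightarrow> (\<forall>k. Ck_on k S f)"

text \<open>Partial derivatives on \<open>[0,T]\<^sup>2\<close>, one-sided at the boundary.\<close>

definition partial_1 :: "real \<Rightarrow> (real \<times> real \<Rightarrow> real) \<Rightarrow> real \<times> real \<Rightarrow> real"
  where "partial_1 T f r = vector_derivative (\<lambda>x. f (x, snd r)) (at (fst r) within {0..T})"

definition partial_2 :: "real \<Rightarrow> (real \<times> real \<Rightarrow> real) \<Rightarrow> real \<times> real \<Rightarrow> real"
  where "partial_2 T f r = vector_derivative (\<lambda>y. f (fst r, y)) (at (snd r) within {0..T})"

definition mixed_partial :: "real \<Rightarrow> (real \<times> real \<Rightarrow> real) \<Rightarrow> real \<times> real \<Rightarrow> real"
  where "mixed_partial T f = partial_1 T (partial_2 T f)"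

text \<open>\<open>field_integral T X i s t f\<close> is the integral of \<open>f\<close> against \<open>d\<^sup>iX\<close> over the rectangle
  \<open>[s,t]\<close>, which is \<open>cbox s t\<close> in \<open>real \<times> real\<close>.\<close>

definition field_integral ::
  "real \<Rightarrow> (real \<times> real \<Rightarrow> real ^ 'd) \<Rightarrow> 'd \<Rightarrow> real \<times> real \<Rightarrow> real \<times> real
    \<Rightarrow> (real \<times> real \<Rightarrow> 'b::euclidean_space) \<Rightarrow> 'b"
where
  "field_integral T X i s t f =
     integral (cbox s t) (\<lambda>r. mixed_partial T (\<lambda>p. X p $ i) r *\<^sub>R f r)"

definition rect_increment ::
  "real \<times> real \<Rightarrow> real \<times> real \<Rightarrow> (real \<times> real \<Rightarrow> 'b::real_vector) \<Rightarrow> 'b"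
where
  "rect_increment s t Y =
     Y (fst t, snd t) - Y (fst s, snd t) - Y (fst t, snd s) + Y (fst s, snd s)"

text \<open>Words over \<open>{1,\<dots>,d}\<close> are lists over the finite index type \<open>'d\<close>.\<close>

fun id_sig ::
  "real \<Rightarrow> (real \<times> real \<Rightarrow> real ^ 'd) \<Rightarrow> real \<times> real \<Rightarrow> real \<times> real \<Rightarrow> 'd list \<Rightarrow> real"
where
  "id_sig T X s t w =
     (if w = [] then 1
      else field_integral T X (last w) s t (\<lambda>r. id_sig T X s r (butlast w)))"

declare id_sig.simps [simp del]

lemma id_sig_Nil: "id_sig T X s t [] = 1"
  by (simp add: id_sig.simps)

lemma id_sig_snoc:
  "id_sig T X s t (w @ [i]) = field_integral T X i s t (\<lambda>r. id_sig T X s r w)"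
  by (subst id_sig.simps) simp

text \<open>For \<open>w = [i\<^sub>1, \<dots>, i\<^sub>n]\<close> this is the product of the \<open>A i\<close> in reversed order,
  \<open>A i\<^sub>n ** \<dots> ** A i\<^sub>1\<close>.\<close>

primrec word_matrix :: "('d \<Rightarrow> real ^ 'e ^ 'e) \<Rightarrow> 'd list \<Rightarrow> real ^ 'e ^ 'e"
where
  "word_matrix A [] = mat 1"
| "word_matrix A (i # w) = word_matrix A w ** A i"

end

theory Submission
  imports Defs
begin

text \<open>
  Picard iteration. Appending a letter \<open>i\<close> to a word \<open>w\<close> turns the term
  \<open>\<langle>S\<^sup>i\<^sup>d, w\<rangle> A\<^sup>\<circ>\<^sup>w v\<close> into its integral against \<open>A\<^sup>i d\<^sup>iX\<close>. Hence the difference of \<open>Y\<close> and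
  the sum over words shorter than \<open>n\<close> is an \<open>n\<close>-fold iterated integral of \<open>Y\<close>, which is
  \<open>O(c\<^sup>n / n!)\<close>. The same estimate for single words gives absolute summability, so the
  limit along word length is the unconditional sum. Finally \<open>Y = v\<close> on the lower edges of the
  rectangle, so \<open>rect_increment s t Y = Y t - v\<close>.
\<close>

section \<open>Continuity of the mixed derivative on the closed square\<close>

text \<open>The nested \<open>vector_derivative\<close> in \<open>mixed_partial\<close> is a choice,
  so it must first be identified. The chain rule along axis-parallel segments, used twice, yields
  \<open>D2 r (1, 0) $ i\<close>, which \<open>Ck_on 2\<close> makes continuous.\<close>

lemma mixed_partial_continuous_on:
  fixes X :: "real \<times> real \<Rightarrow> real ^ 'd"
  assumes "T > 0" and "Ck_on 2 (cbox (0, 0) (T, T)) X"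
  shows "continuous_on (cbox (0, 0) (T, T)) (mixed_partial T (\<lambda>p. X p $ i))"
proof -
  let ?S = "cbox (0, 0) (T, T) :: (real \<times> real) set"
  have "Ck_on (Suc (Suc 0)) ?S X"
    using assms(2) by (simp add: numeral_2_eq_2)
  then obtain D where D: "\<And>x. x \<in> ?S \<Longrightarrow> (X has_derivative D x) (at x within ?S)"
    and "\<And>h. Ck_on (Suc 0) ?S (\<lambda>x. D x h)"
    unfolding Ck_on.simps(2)[of "Suc 0"] by blast
  \<comment> \<open>The direction \<open>(0, 1)\<close> comes first because
    \<open>mixed_partial\<close> applies \<open>partial_1\<close> to
    \<open>partial_2\<close>.\<close>
  then obtain D2 where
    D2: "\<And>x. x \<in> ?S \<Longrightarrow> ((\<lambda>x. D x (0, 1)) has_derivative D2 x) (at x within ?S)"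
    and D2_cont: "\<And>h. continuous_on ?S (\<lambda>x. D2 x h)"
    unfolding Ck_on.simps by blast
  have p2: "partial_2 T (\<lambda>p. X p $ i) (x, y) = D (x, y) (0, 1) $ i"
    if "x \<in> {0..T}" "y \<in> {0..T}" for x y
  proof -
    have "((X \<circ> (\<lambda>y. (x, y))) has_derivative D (x, y) \<circ> (\<lambda>h. (0, h))) (at y within {0..T})"
      using that
      by (intro diff_chain_within has_derivative_subset[OF D])
        (auto intro!: derivative_eq_intros)
    moreover have "linear (D (x, y))"
      using D[of "(x, y)"] that by (auto intro: has_derivative_linear)
    then have "D (x, y) \<circ> (\<lambda>h. (0, h)) = (\<lambda>h. h *\<^sub>R D (x, y) (0, 1))"
      by (simp add: fun_eq_iff flip: linear_cmul)
    ultimately have "((\<lambda>y. X (x, y)) has_vector_derivative D (x, y) (0, 1)) (at y within {0..T})"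
      by (simp only: has_vector_derivative_def o_def)
    \<comment> \<open>Since \<open>T > 0\<close>, derivatives within \<open>{0..T}\<close> are
      unique, also at the endpoints, so \<open>vector_derivative\<close> returns this value.\<close>
    from bounded_linear.has_vector_derivative[OF bounded_linear_vec_nth this]
    show ?thesis
      unfolding partial_2_def
      using assms(1) that by (auto intro!: vector_derivative_within_closed_interval)
  qed
  have "mixed_partial T (\<lambda>p. X p $ i) (x, y) = D2 (x, y) (1, 0) $ i"
    if "x \<in> {0..T}" "y \<in> {0..T}" for x y
  proof -
    have "(((\<lambda>x. D x (0, 1)) \<circ> (\<lambda>x. (x, y))) has_derivative D2 (x, y) \<circ> (\<lambda>h. (h, 0)))
            (at x within {0..T})"
      using that
      by (intro diff_chain_within has_derivative_subset[OF D2])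
        (auto intro!: derivative_eq_intros)
    moreover have "linear (D2 (x, y))"
      using D2[of "(x, y)"] that by (auto intro: has_derivative_linear)
    then have "D2 (x, y) \<circ> (\<lambda>h. (h, 0)) = (\<lambda>h. h *\<^sub>R D2 (x, y) (1, 0))"
      by (simp add: fun_eq_iff flip: linear_cmul)
    ultimately have "((\<lambda>x. D (x, y) (0, 1)) has_vector_derivative D2 (x, y) (1, 0))
        (at x within {0..T})"
      by (simp only: has_vector_derivative_def o_def)
    from bounded_linear.has_vector_derivative[OF bounded_linear_vec_nth this]
    have "((\<lambda>x. D (x, y) (0, 1) $ i) has_vector_derivative D2 (x, y) (1, 0) $ i)
        (at x within {0..T})" .
    \<comment> \<open>\<open>p2\<close> holds on the whole closed segment, so the inner derivative
      can be replaced before differentiating within \<open>{0..T}\<close>.\<close>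
    then have "((\<lambda>x. partial_2 T (\<lambda>p. X p $ i) (x, y)) has_vector_derivative
        D2 (x, y) (1, 0) $ i) (at x within {0..T})"
      by (rule has_vector_derivative_transform[rotated 2]) (use p2 that in auto)
    then show ?thesis
      unfolding mixed_partial_def partial_1_def
      using assms(1) that by (auto intro!: vector_derivative_within_closed_interval)
  qed
  then have "mixed_partial T (\<lambda>p. X p $ i) r = D2 r (1, 0) $ i" if "r \<in> ?S" for r
    using that by (cases r) auto
  moreover have "continuous_on ?S (\<lambda>r. D2 r (1, 0) $ i)"
    by (intro continuous_intros D2_cont)
  ultimately show ?thesis
    by (simp cong: continuous_on_cong)
qed

section \<open>Integrals over rectangles\<close>

text \<open>The integral is jointly continuous in both corners; the lower one is frozen at
  \<open>s\<close>. This keeps iterated integrals continuous, so that they can be integrated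
  again.\<close>

lemma continuous_on_integral_upper_corner:
  fixes h :: "'a::euclidean_space \<Rightarrow> 'b::euclidean_space"
  assumes "h integrable_on cbox s b"
  shows "continuous_on (cbox s b) (\<lambda>u. integral (cbox s u) h)"
proof (cases "cbox s b = {}")
  case False
  then have "s \<in> cbox s b"
    by (auto simp: box_ne_empty mem_box)
  have "continuous_on (cbox (s, s) (b, b)) (\<lambda>y. integral (cbox (fst y) (snd y)) h)"
    using indefinite_integral_uniformly_continuous[OF assms] uniformly_continuous_imp_continuous
    by blast
  then have "continuous_on (cbox s b)
      (\<lambda>u. integral (cbox (fst (s, u)) (snd (s, u))) h)"
    by (rule continuous_on_compose2)
      (use \<open>s \<in> cbox s b\<close> in \<open>auto intro!: continuous_intros\<close>)
  then show ?thesis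
    by simp
qed simp

text \<open>Fubini and the antiderivative of a power. Growth is tracked in the first coordinate
  only; the second costs at most the length \<open>L\<close> per integration. The single factorial
  so obtained already suffices for convergence.\<close>

lemma norm_integral_le_power_fst:
  fixes h :: "real \<times> real \<Rightarrow> 'b::euclidean_space"
  assumes "h integrable_on cbox s u" "fst s \<le> fst u" "snd s \<le> snd u" "snd u - snd s \<le> L"
    and "C \<ge> 0"
    and "\<And>r. r \<in> cbox s u \<Longrightarrow> norm (h r) \<le> C * (fst r - fst s) ^ n / fact n"
  shows "norm (integral (cbox s u) h) \<le> L * C * (fst u - fst s) ^ Suc n / fact (Suc n)"
proof -
  obtain s1 s2 u1 u2 where su: "s = (s1, s2)" "u = (u1, u2)"
    by (cases s, cases u)
  let ?g = "\<lambda>r :: real \<times> real. C * (fst r - s1) ^ n / fact n"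
  have cont: "continuous_on (cbox s u) ?g"
    by (intro continuous_intros) auto
  have "norm (integral (cbox s u) h) \<le> integral (cbox s u) ?g"
    using assms(6) integrable_continuous[OF cont]
    by (intro Henstock_Kurzweil_Integration.integral_norm_bound_integral assms(1))
      (auto simp: su)
  also have "integral (cbox s u) ?g =
      integral {s1..u1} (\<lambda>x. (u2 - s2) * C * (x - s1) ^ n / fact n)"
    using integral_prod_continuous[of s1 s2 u1 u2 ?g] cont assms(3)
    by (simp add: su mult_ac)
  also have "\<dots> = (u2 - s2) * C * (u1 - s1) ^ Suc n / fact (Suc n) -
      (u2 - s2) * C * (s1 - s1) ^ Suc n / fact (Suc n)"
  proof (intro integral_unique fundamental_theorem_of_calculus)
    show "s1 \<le> u1"
      using assms(2) by (simp add: su)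
    fix x
    have "((\<lambda>x. (u2 - s2) * C * (x - s1) ^ Suc n / fact (Suc n)) has_real_derivative
        (u2 - s2) * C * (x - s1) ^ n / fact n) (at x within {s1..u1})"
      by (auto intro!: derivative_eq_intros simp: divide_simps simp del: power_Suc)
    then show "((\<lambda>x. (u2 - s2) * C * (x - s1) ^ Suc n / fact (Suc n)) has_vector_derivative
        (u2 - s2) * C * (x - s1) ^ n / fact n) (at x within {s1..u1})"
      by (simp add: has_real_derivative_iff_has_vector_derivative)
  qed
  \<comment> \<open>The lower endpoint contributes 0 because the exponent \<open>Suc n\<close> is
    positive.\<close>
  also have "\<dots> \<le> L * C * (u1 - s1) ^ Suc n / fact (Suc n)"
    using assms(2-5) by (auto simp: su intro!: divide_right_mono mult_right_mono)
  finally show ?thesis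
    by (simp add: su)
qed

section \<open>Words sorted by length\<close>

text \<open>Splitting off the last letter, rather than the first, matches the recursion of
  \<open>id_sig\<close>.\<close>

lemma words_shorter_Suc:
  "{w :: 'd list. length w < Suc n} =
    insert [] ((\<lambda>(w, i). w @ [i]) ` ({w. length w < n} \<times> UNIV))"
proof (intro set_eqI iffI)
  fix w :: "'d list"
  assume "w \<in> {w. length w < Suc n}"
  then show "w \<in> insert [] ((\<lambda>(w, i). w @ [i]) ` ({w. length w < n} \<times> UNIV))"
    by (cases w rule: rev_cases) (auto simp: image_iff)
qed auto

lemma finite_words_shorter: "finite {w :: 'd::finite list. length w < n}"
  by (induction n) (simp_all only: words_shorter_Suc, simp_all)

text \<open>This is the shape of a Picard step: a constant term from the empty word, and one more
  integration for each appended letter.\<close>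

lemma sum_words_shorter_Suc:
  fixes g :: "'d::finite list \<Rightarrow> 'b::comm_monoid_add"
  shows "(\<Sum>w | length w < Suc n. g w) = g [] + (\<Sum>w | length w < n. \<Sum>i\<in>UNIV. g (w @ [i]))"
proof -
  have "(\<Sum>w | length w < Suc n. g w) =
      g [] + sum g ((\<lambda>(w, i). w @ [i]) ` ({w. length w < n} \<times> UNIV))"
    unfolding words_shorter_Suc
    by (subst sum.insert) (auto simp: finite_words_shorter)
  also have "sum g ((\<lambda>(w, i). w @ [i]) ` ({w. length w < n} \<times> UNIV)) =
      (\<Sum>(w, i)\<in>{w. length w < n} \<times> UNIV. g (w @ [i]))"
    by (subst sum.reindex) (auto simp: inj_on_def intro!: sum.cong)
  finally show ?thesis
    by (simp add: sum.cartesian_product)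
qed

text \<open>There are \<open>CARD('d) ^ k\<close> words of length \<open>k\<close>, so grouping by
  length gives a partial sum of the exponential series.\<close>

lemma words_length_sum_le_exp:
  fixes c :: real
  assumes "c \<ge> 0"
  shows "(\<Sum>w | length (w :: 'd::finite list) < n. c ^ length w / fact (length w))
    \<le> exp (CARD('d) * c)"
proof -
  have "(\<Sum>w | length (w :: 'd list) < n. c ^ length w / fact (length w)) =
      (\<Sum>k<n. (CARD('d) * c) ^ k / fact k)"
  proof (induction n)
    case (Suc n)
    have "{w :: 'd list. length w < Suc n} = {w. length w < n} \<union> {w. length w = n}"
      by auto
    moreover have "finite {w :: 'd list. length w = n}"
      using finite_words_shorter[of "Suc n"] by (rule rev_finite_subset) auto
    moreover have "card {w :: 'd list. length w = n} = CARD('d) ^ n"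
      using card_lists_length_eq[of "UNIV :: 'd set" n] by simp
    moreover have "{w :: 'd list. length w < n} \<inter> {w. length w = n} = {}"
      by auto
    ultimately have "(\<Sum>w | length (w :: 'd list) < Suc n. c ^ length w / fact (length w)) =
        (\<Sum>w | length (w :: 'd list) < n. c ^ length w / fact (length w)) +
        CARD('d) ^ n * (c ^ n / fact n)"
      by (simp add: sum.union_disjoint finite_words_shorter)
    then show ?case
      by (simp add: Suc power_mult_distrib)
  qed simp
  also have "\<dots> \<le> exp (CARD('d) * c)"
    using sum_le_suminf[OF summable_exp_generic[of "CARD('d) * c"], of "{..<n}"] assms
    by (simp add: exp_def divide_inverse mult.commute)
  finally show ?thesis .
qed

text \<open>A finite set of words has bounded length. Hence an unconditional sum can be evaluated
  along truncations by length.\<close>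

lemma filterlim_words_shorter:
  "filterlim (\<lambda>n. {w :: 'd::finite list. length w < n}) (finite_subsets_at_top UNIV) sequentially"
  unfolding filterlim_finite_subsets_at_top
proof (intro allI impI)
  fix F :: "'d list set"
  assume F: "finite F \<and> F \<subseteq> UNIV"
  \<comment> \<open>For empty \<open>F\<close> the value of \<open>Max\<close> is unspecified, but
    then there is no \<open>w\<close> to bound.\<close>
  have "length w < n" if "w \<in> F" "n \<ge> Suc (Max (length ` F))" for w n
  proof -
    have "length w \<le> Max (length ` F)"
      using F that(1) by (intro Max_ge) auto
    then show ?thesis
      using that(2) by linarith
  qed
  then have "F \<subseteq> {w. length w < n}" if "n \<ge> Suc (Max (length ` F))" for n
    using that by blast
  then show "\<forall>\<^sub>F n in sequentially. finite {w :: 'd list. length w < n} \<and>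
      F \<subseteq> {w. length w < n} \<and> {w :: 'd list. length w < n} \<subseteq> UNIV"
    unfolding eventually_sequentially using finite_words_shorter by blast
qed

section \<open>Integration against the mixed derivative over a fixed rectangle\<close>

context
  fixes T :: real and X :: "real \<times> real \<Rightarrow> real ^ 'd" and s b :: "real \<times> real"
  assumes mixed_cont: "\<And>i. continuous_on (cbox s b) (mixed_partial T (\<lambda>p. X p $ i))"
begin

lemma field_integrand_integrable:
  fixes f :: "real \<times> real \<Rightarrow> 'b::euclidean_space"
  assumes "continuous_on (cbox s b) f" "u \<in> cbox s b"
  shows "(\<lambda>r. mixed_partial T (\<lambda>p. X p $ i) r *\<^sub>R f r) integrable_on cbox s u"
proof -
  have "cbox s u \<subseteq> cbox s b"
    using assms(2) by (cases s, cases u, cases b) auto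
  then show ?thesis
    using assms(1) mixed_cont
    by (intro integrable_continuous continuous_intros) (auto intro: continuous_on_subset)
qed

lemma continuous_on_field_integral:
  fixes f :: "real \<times> real \<Rightarrow> 'b::euclidean_space"
  assumes "continuous_on (cbox s b) f"
  shows "continuous_on (cbox s b) (\<lambda>u. field_integral T X i s u f)"
  unfolding field_integral_def
  by (intro continuous_on_integral_upper_corner integrable_continuous continuous_intros
      mixed_cont assms)

lemma continuous_on_id_sig: "continuous_on (cbox s b) (\<lambda>u. id_sig T X s u w)"
  by (induction w rule: rev_induct)
    (simp_all add: id_sig_Nil id_sig_snoc continuous_on_field_integral)

lemma field_integral_bounded_linear:
  fixes f :: "real \<times> real \<Rightarrow> 'b::euclidean_space" and h :: "'b \<Rightarrow> 'c::euclidean_space"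
  assumes "continuous_on (cbox s b) f" "u \<in> cbox s b" "bounded_linear h"
  shows "field_integral T X i s u (\<lambda>r. h (f r)) = h (field_integral T X i s u f)"
  using integral_linear[OF field_integrand_integrable[OF assms(1,2), of i] assms(3)]
  by (simp add: field_integral_def o_def linear_cmul bounded_linear.linear[OF assms(3)])

lemma field_integral_diff:
  fixes f g :: "real \<times> real \<Rightarrow> 'b::euclidean_space"
  assumes "continuous_on (cbox s b) f" "continuous_on (cbox s b) g" "u \<in> cbox s b"
  shows "field_integral T X i s u (\<lambda>r. f r - g r) =
    field_integral T X i s u f - field_integral T X i s u g"
  unfolding field_integral_def
  by (simp add: scaleR_diff_right Henstock_Kurzweil_Integration.integral_diff
      field_integrand_integrable assms)

lemma field_integral_sum:
  fixes f :: "'k \<Rightarrow> real \<times> real \<Rightarrow> 'b::euclidean_space"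
  assumes "finite K" "\<And>k. k \<in> K \<Longrightarrow> continuous_on (cbox s b) (f k)" "u \<in> cbox s b"
  shows "field_integral T X i s u (\<lambda>r. \<Sum>k\<in>K. f k r) = (\<Sum>k\<in>K. field_integral T X i s u (f k))"
  unfolding field_integral_def
  by (simp add: scaleR_sum_right Henstock_Kurzweil_Integration.integral_sum
      field_integrand_integrable assms)

text \<open>The height is taken from the full box, not from \<open>u\<close>, so the constant is the
  same for all \<open>u\<close> and the estimate can be iterated.\<close>

lemma norm_field_integral_matrix_le:
  fixes f :: "real \<times> real \<Rightarrow> real ^ 'n" and A :: "real ^ 'n ^ 'm"
  assumes "continuous_on (cbox s b) f" "u \<in> cbox s b" "C \<ge> 0" "M \<ge> 0" "B \<ge> 0"
    and M: "\<And>r. r \<in> cbox s b \<Longrightarrow> \<bar>mixed_partial T (\<lambda>p. X p $ i) r\<bar> \<le> M"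
    and B: "\<And>x. norm (A *v x) \<le> B * norm x"
    and f: "\<And>r. r \<in> cbox s b \<Longrightarrow> norm (f r) \<le> C * (fst r - fst s) ^ n / fact n"
  shows "norm (field_integral T X i s u (\<lambda>r. A *v f r)) \<le>
    (snd b - snd s) * M * B * C * (fst u - fst s) ^ Suc n / fact (Suc n)"
proof -
  have u: "fst s \<le> fst u" "snd s \<le> snd u" "snd u \<le> snd b" "cbox s u \<subseteq> cbox s b"
    using assms(2) by (cases s; cases u; cases b; auto)+
  have "continuous_on (cbox s b) (\<lambda>r. A *v f r)"
    using assms(1) by (intro bounded_linear.continuous_on[OF matrix_vector_mul_bounded_linear])
  moreover have "norm (mixed_partial T (\<lambda>p. X p $ i) r *\<^sub>R (A *v f r)) \<le>
      (M * (B * C)) * (fst r - fst s) ^ n / fact n" if "r \<in> cbox s u" for r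
  proof -
    have r: "r \<in> cbox s b"
      using that u by blast
    have "norm (mixed_partial T (\<lambda>p. X p $ i) r *\<^sub>R (A *v f r)) \<le> M * (B * norm (f r))"
      using M[OF r] B[of "f r"] assms(4) by (auto intro!: mult_mono)
    also have "\<dots> \<le> M * (B * (C * (fst r - fst s) ^ n / fact n))"
      using f[OF r] assms(4,5) by (intro mult_left_mono)
    finally show ?thesis
      by (simp add: mult_ac)
  qed
  ultimately have "norm (field_integral T X i s u (\<lambda>r. A *v f r)) \<le>
      (snd b - snd s) * (M * (B * C)) * (fst u - fst s) ^ Suc n / fact (Suc n)"
    unfolding field_integral_def using assms(2-5) u
    by (intro norm_integral_le_power_fst field_integrand_integrable) auto
  then show ?thesis
    by (simp add: mult_ac)
qed

text \<open>The new letter multiplies the matrix product on the left, and constant vectors pass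
  through the integral.\<close>

lemma id_sig_word_matrix_snoc:
  fixes A :: "'d \<Rightarrow> real ^ 'e ^ 'e"
  assumes "u \<in> cbox s b"
  shows "id_sig T X s u (w @ [i]) *\<^sub>R (word_matrix A (w @ [i]) *v v) =
    field_integral T X i s u (\<lambda>r. A i *v (id_sig T X s r w *\<^sub>R (word_matrix A w *v v)))"
proof -
  \<comment> \<open>\<open>word_matrix\<close> recurses on the first letter, so appending a letter
    needs induction and associativity.\<close>
  have "word_matrix A (w @ [i]) = A i ** word_matrix A w"
    by (induction w) (simp_all add: matrix_mul_assoc)
  moreover have "field_integral T X i s u
      (\<lambda>r. id_sig T X s r w *\<^sub>R (A i *v (word_matrix A w *v v))) =
      field_integral T X i s u (\<lambda>r. id_sig T X s r w) *\<^sub>R (A i *v (word_matrix A w *v v))"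
    by (intro field_integral_bounded_linear continuous_on_id_sig assms bounded_linear_scaleR_left)
  ultimately show ?thesis
    by (simp add: id_sig_snoc matrix_vector_mul_assoc matrix_vector_mult_scaleR)
qed

section \<open>Convergence of the Picard expansion\<close>

lemma linear_field_equation_has_sum:
  fixes A :: "'d \<Rightarrow> real ^ 'e ^ 'e"
  assumes Y_cont: "continuous_on (cbox s b) Y"
    and Y: "\<And>u. u \<in> cbox s b \<Longrightarrow>
           Y u = v + (\<Sum>i\<in>UNIV. field_integral T X i s u (\<lambda>r. A i *v Y r))"
    and t: "t \<in> cbox s b"
  shows "((\<lambda>w. id_sig T X s t w *\<^sub>R (word_matrix A w *v v)) has_sum Y t) UNIV"
proof -
  define g where "g w u = id_sig T X s u w *\<^sub>R (word_matrix A w *v v)" for w u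
  have g_cont: "continuous_on (cbox s b) (g w)" for w
    unfolding g_def by (intro continuous_intros continuous_on_id_sig)
  have g_snoc: "g (w @ [i]) u = field_integral T X i s u (\<lambda>r. A i *v g w r)"
    if "u \<in> cbox s b" for w i u
    unfolding g_def using that by (rule id_sig_word_matrix_snoc)
  have "\<exists>M\<ge>0. \<forall>r\<in>cbox s b. \<bar>mixed_partial T (\<lambda>p. X p $ i) r\<bar> \<le> M" for i
    using compact_continuous_image[OF mixed_cont compact_cbox, THEN compact_imp_bounded, of i]
    by (auto simp: bounded_pos) (meson less_imp_le)
  then obtain m where m: "\<And>i. m i \<ge> 0"
      "\<And>i r. r \<in> cbox s b \<Longrightarrow> \<bar>mixed_partial T (\<lambda>p. X p $ i) r\<bar> \<le> m i"
    by metis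
  \<comment> \<open>Summing over letters majorises each single bound, which makes \<open>M\<close>
    and \<open>B\<close> independent of the letter.\<close>
  define M where "M = sum m UNIV"
  define B where "B = (\<Sum>i\<in>UNIV. onorm ((*v) (A i)))"
  have onorm_nonneg: "onorm ((*v) (A i)) \<ge> 0" for i
    by (intro onorm_pos_le matrix_vector_mul_bounded_linear)
  have MB: "M \<ge> 0" "B \<ge> 0"
    unfolding M_def B_def by (auto intro!: sum_nonneg m onorm_nonneg)
  have M: "\<bar>mixed_partial T (\<lambda>p. X p $ i) r\<bar> \<le> M" if "r \<in> cbox s b" for i r
    using m(2)[OF that, of i] member_le_sum[of i UNIV m] m(1) by (auto simp: M_def)
  have B: "norm (A i *v x) \<le> B * norm x" for i x
  proof -
    have "norm (A i *v x) \<le> onorm ((*v) (A i)) * norm x"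
      by (intro onorm matrix_vector_mul_bounded_linear)
    also have "\<dots> \<le> B * norm x"
      using member_le_sum[of i UNIV "\<lambda>i. onorm ((*v) (A i))"] onorm_nonneg
      by (intro mult_right_mono) (auto simp: B_def)
    finally show ?thesis .
  qed
  \<comment> \<open>The cost of one integration. The horizontal side is left out because its powers
    carry the factorial.\<close>
  define K where "K = (snd b - snd s) * M * B"
  have corner: "fst s \<le> fst t" "snd s \<le> snd b"
    using t by (cases s; cases t; cases b; auto)+
  then have K: "K \<ge> 0"
    using MB by (simp add: K_def)
  have step: "norm (field_integral T X i s u (\<lambda>r. A i *v f r)) \<le>
      K * C * (fst u - fst s) ^ Suc n / fact (Suc n)"
    if "continuous_on (cbox s b) f" "u \<in> cbox s b" "C \<ge> 0"
      "\<And>r. r \<in> cbox s b \<Longrightarrow> norm (f r) \<le> C * (fst r - fst s) ^ n / fact n" for i f u C n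
    unfolding K_def by (intro norm_field_integral_matrix_le that MB M B)
  have g_bound: "norm (g w u) \<le> norm v * K ^ length w * (fst u - fst s) ^ length w / fact (length w)"
    if "u \<in> cbox s b" for w u
    using that
  proof (induction w arbitrary: u rule: rev_induct)
    case (snoc i w)
    have "norm (g (w @ [i]) u) \<le>
        K * (norm v * K ^ length w) * (fst u - fst s) ^ Suc (length w) / fact (Suc (length w))"
      unfolding g_snoc[OF snoc.prems] using K by (intro step g_cont snoc) auto
    then show ?case
      by (simp add: mult_ac)
  qed (simp add: g_def id_sig_Nil)
  \<comment> \<open>The Picard remainder; \<open>R 0\<close> is \<open>Y\<close>, as no word has
    negative length.\<close>
  define R where "R n u = Y u - (\<Sum>w | length w < n. g w u)" for n u
  have R_cont: "continuous_on (cbox s b) (R n)" for n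
    unfolding R_def by (intro continuous_intros Y_cont g_cont)
  have R_Suc: "R (Suc n) u = (\<Sum>i\<in>UNIV. field_integral T X i s u (\<lambda>r. A i *v R n r))"
    if u: "u \<in> cbox s b" for n u
  proof -
    have A_cont: "continuous_on (cbox s b) (\<lambda>r. A i *v f r)"
      if "continuous_on (cbox s b) f" for i f
      using that by (intro bounded_linear.continuous_on[OF matrix_vector_mul_bounded_linear])
    have "field_integral T X i s u (\<lambda>r. A i *v R n r) =
        field_integral T X i s u (\<lambda>r. A i *v Y r) - (\<Sum>w | length w < n. g (w @ [i]) u)" for i
    proof -
      have "field_integral T X i s u (\<lambda>r. A i *v R n r) =
          field_integral T X i s u (\<lambda>r. A i *v Y r - (\<Sum>w | length w < n. A i *v g w r))"
        by (simp add: R_def matrix_vector_mult_diff_distrib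
            linear_sum[OF matrix_vector_mul_linear])
      also have "\<dots> = field_integral T X i s u (\<lambda>r. A i *v Y r) -
          (\<Sum>w | length w < n. field_integral T X i s u (\<lambda>r. A i *v g w r))"
        using field_integral_diff[of "\<lambda>r. A i *v Y r"
            "\<lambda>r. \<Sum>w | length w < n. A i *v g w r" u i]
          field_integral_sum[of "{w. length w < n}" "\<lambda>w r. A i *v g w r" u i] u
        by (simp add: finite_words_shorter continuous_on_sum A_cont Y_cont g_cont)
      finally show ?thesis
        using u by (simp add: g_snoc)
    qed
    then have "(\<Sum>i\<in>UNIV. field_integral T X i s u (\<lambda>r. A i *v R n r)) =
        Y u - v - (\<Sum>i\<in>UNIV. \<Sum>w | length w < n. g (w @ [i]) u)"
      using Y[OF u] by (simp add: sum_subtractf)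
    \<comment> \<open>The empty word contributes exactly \<open>v\<close>, which cancels the
      constant of the equation.\<close>
    also have "\<dots> = R (Suc n) u"
      unfolding R_def sum_words_shorter_Suc
      by (subst sum.swap) (simp add: g_def id_sig_Nil)
    finally show ?thesis
      by simp
  qed
  obtain C where C: "C \<ge> 0" "\<And>u. u \<in> cbox s b \<Longrightarrow> norm (Y u) \<le> C"
    using compact_continuous_image[OF Y_cont compact_cbox, THEN compact_imp_bounded]
    by (auto simp: bounded_pos) (meson less_imp_le)
  \<comment> \<open>Each step from \<open>R n\<close> to \<open>R (Suc n)\<close> sums over all
    letters, which costs a further factor \<open>N\<close>.\<close>
  define N where "N = real CARD('d)"
  have R_bound: "norm (R n u) \<le> C * (N * K) ^ n * (fst u - fst s) ^ n / fact n"
    if "u \<in> cbox s b" for n u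
    using that
  proof (induction n arbitrary: u)
    case (Suc n)
    have "norm (R (Suc n) u) \<le>
        (\<Sum>i\<in>(UNIV :: 'd set). K * (C * (N * K) ^ n) * (fst u - fst s) ^ Suc n / fact (Suc n))"
      unfolding R_Suc[OF Suc.prems] using K C
      by (intro sum_norm_le step R_cont Suc) (auto simp: N_def)
    then show ?case
      by (simp add: N_def mult_ac)
  qed (simp add: R_def C)
  define c where "c = K * (fst t - fst s)"
  have "c \<ge> 0"
    using K corner by (simp add: c_def)
  have "(\<lambda>n. C * ((N * c) ^ n / fact n)) \<longlonglongrightarrow> C * 0"
    using summable_LIMSEQ_zero[OF summable_exp[of "N * c"]]
    by (intro tendsto_mult_left) (simp add: divide_inverse mult_ac)
  moreover have "norm (R n t) \<le> C * ((N * c) ^ n / fact n)" for n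
    using R_bound[OF t, of n] by (simp add: c_def power_mult_distrib mult_ac)
  ultimately have "(\<lambda>n. R n t) \<longlonglongrightarrow> 0"
    by (auto intro: Lim_null_comparison[where g = "\<lambda>n. C * ((N * c) ^ n / fact n)"])
  then have "(\<lambda>n. Y t - R n t) \<longlonglongrightarrow> Y t - 0"
    by (intro tendsto_diff tendsto_const)
  then have lim: "(\<lambda>n. \<Sum>w | length w < n. g w t) \<longlonglongrightarrow> Y t"
    by (simp add: R_def)
  \<comment> \<open>Any finite set of words lies among those shorter than some \<open>n\<close>, so
    the exponential bound is uniform over finite sets.\<close>
  have "(\<lambda>w. norm (g w t)) summable_on UNIV"
  proof (rule nonneg_bdd_above_summable_on)
    have "sum (\<lambda>w. norm (g w t)) F \<le> norm v * exp (CARD('d) * c)" if "finite F" for F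
    proof -
      have "\<forall>\<^sub>F n in sequentially. F \<subseteq> {w. length w < n}"
        using filterlim_words_shorter[where ?'d = 'd, unfolded filterlim_finite_subsets_at_top,
            rule_format, of F] that
        by (auto elim: eventually_mono)
      then obtain n where n: "F \<subseteq> {w. length w < n}"
        using eventually_happens'[OF sequentially_bot] by blast
      have "sum (\<lambda>w. norm (g w t)) F \<le> (\<Sum>w | length w < n. norm (g w t))"
        using n by (intro sum_mono2 finite_words_shorter) auto
      also have "\<dots> \<le> (\<Sum>w | length (w :: 'd list) < n. norm v * (c ^ length w / fact (length w)))"
        using g_bound[OF t] by (intro sum_mono) (simp add: c_def power_mult_distrib mult_ac)
      also have "\<dots> \<le> norm v * exp (CARD('d) * c)"
        using words_length_sum_le_exp[OF \<open>c \<ge> 0\<close>, where ?'d = 'd]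
        unfolding sum_distrib_left[symmetric] by (rule mult_left_mono) simp
      finally show ?thesis .
    qed
    then show "bdd_above (sum (\<lambda>w. norm (g w t)) ` {F. F \<subseteq> UNIV \<and> finite F})"
      by (intro bdd_aboveI2[of _ _ "norm v * exp (CARD('d) * c)"]) auto
  qed auto
  then obtain l where l: "((\<lambda>w. g w t) has_sum l) UNIV"
    using abs_summable_summable[of "\<lambda>w. g w t"] by (auto simp: summable_on_def)
  \<comment> \<open>The unconditional sum \<open>l\<close> is also the limit along word length, and
    that limit is already known to be \<open>Y t\<close>.\<close>
  then have "(\<lambda>n. \<Sum>w | length w < n. g w t) \<longlonglongrightarrow> l"
    unfolding has_sum_def using filterlim_words_shorter by (rule filterlim_compose)
  then have "l = Y t"
    using lim by (rule LIMSEQ_unique)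
  then show ?thesis
    using l by (simp add: g_def)
qed

end

theorem lemma4p3:
  fixes T :: real
    and X :: "real \<times> real \<Rightarrow> real ^ 'd"
    and A :: "'d \<Rightarrow> real ^ 'e ^ 'e"
    and v :: "real ^ 'e"
    and s t :: "real \<times> real"
    and Y :: "real \<times> real \<Rightarrow> real ^ 'e"
  assumes "T > 0"
    and "smooth_on (cbox (0, 0) (T, T)) X"
    and "s \<in> cbox (0, 0) (T, T)"
    and "continuous_on (cbox s (T, T)) Y"
    and "\<And>u. u \<in> cbox s (T, T) \<Longrightarrow>
           Y u = v + (\<Sum>i\<in>UNIV. field_integral T X i s u (\<lambda>r. A i *v Y r))"
    and "t \<in> cbox s (T, T)"
  shows "((\<lambda>w. id_sig T X s t w *\<^sub>R (word_matrix A w *v v)) has_sum rect_increment s t Y)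
           {w :: 'd list. w \<noteq> []}"
proof -
  have sub: "cbox s (T, T) \<subseteq> cbox (0, 0) (T, T)"
    using assms(3) by (cases s) auto
  have "Ck_on 2 (cbox (0, 0) (T, T)) X"
    using assms(2) by (simp add: smooth_on_def)
  then have cont: "continuous_on (cbox s (T, T)) (mixed_partial T (\<lambda>p. X p $ i))" for i
    using mixed_partial_continuous_on[OF assms(1)] sub continuous_on_subset by blast
  \<comment> \<open>Over a degenerate rectangle all integrals vanish, and the equation reduces to
    its constant term.\<close>
  have edge: "Y u = v" if "u \<in> cbox s (T, T)" "fst u = fst s \<or> snd u = snd s" for u
  proof -
    have "measure lborel (cbox s u) = 0"
      using that by (cases s; cases u) (auto simp: content_Pair)
    then show ?thesis
      using assms(5)[OF that(1)] by (simp add: field_integral_def)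
  qed
  have "rect_increment s t Y = Y t - v"
    using assms(6) edge[of "(fst s, snd t)"] edge[of "(fst t, snd s)"] edge[of "(fst s, snd s)"]
    by (cases s; cases t) (auto simp: rect_increment_def)
  \<comment> \<open>The removed term is that of the empty word: signature 1 and identity matrix,
    hence \<open>v\<close>.\<close>
  moreover have "((\<lambda>w. id_sig T X s t w *\<^sub>R (word_matrix A w *v v)) has_sum Y t - v) (UNIV - {[]})"
    using has_sum_Diff[OF linear_field_equation_has_sum[OF cont assms(4-6)]
        has_sum_finite[of "{[]}"]]
    by (simp add: id_sig_Nil)
  moreover have "{w :: 'd list. w \<noteq> []} = UNIV - {[]}"
    by auto
  ultimately show ?thesis
    by simp
qed

end
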